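(* Let $p > 3$ be a prime number. If $p \equiv 3 \bmod 4$ (resp. $p \equiv 1 \bmod 4$), let $S = (s_n)_{n \geq 0}$ be the sequence over $\mathbb{F}_p$ defined by $s_{n+1} = 4 s_n (s_n + 1)$, $n \geq 0$, with initial value $s_0 \in D_0 \cap (D_0 - 1)$ (resp. $s_0 \in D_1 \cap (D_0 - 1)$). Then $S$ attains a maximal period, i.e. the period of $S$ equals $(p-3)/4$ (resp. $(p-1)/4$), if and only if there exists a prime number $p_1$ such that $$p = 2p_1 + 1 \ \text{ if } p \equiv 3 \bmod 4, \qquad p = 2 p_1 - 1 \ \text{ if } p \equiv 1 \bmod 4,$$ and $$\mathrm{ord}_{p_1} 2 = p_1 - 1, \quad \text{or} \quad \Bigl(\mathrm{ord}_{p_1} 2 = (p_1 - 1)/2 \ \text{ and } \ (p_1-1)/2 \text{ is an odd integer}\Bigr).$$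
   Context: $\mathbb{F}_p$ is the finite field with $p$ elements. $D_0, D_1 \subset \mathbb{F}_p$ denote the set of non-zero quadratic residues modulo $p$ and the set of quadratic non-residues modulo $p$, respectively. For an integer $b$, $D_i - b = \{c \in \mathbb{F}_p \mid c + b \in D_i\}$; thus $a \in D_i \cap (D_0 - 1)$ means $a \in D_i$ and $a + 1 \in D_0$. $\mathrm{ord}_N\, g$ is the order of $g$ in the multiplicative group $(\mathbb{Z}/N\mathbb{Z})^\times$. Period: for an eventually periodic sequence $S = (s_n)_{n\ge 0}$, let $r$ be the least positive integer with $s_r \in \{s_0,\dots,s_{r-1}\}$ and $t$ the least non-negative integer with $s_r = s_t$; the period of $S$ is $c(S) = r - t$. Maximal period: the set $D_0 \cap (D_0-1)$ has $(p-3)/4$ elements if $p \equiv 3 \bmod 4$, and $D_1 \cap (D_0 - 1)$ has $(p-1)/4$ elements if $p \equiv 1 \bmod 4$; these numbers are upper bounds for the period of $S$, and "maximal period" means that the bound is attained. *)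

theory Defs
  imports "HOL-Number_Theory.Number_Theory"
begin

text \<open>
  The elements of the prime field with \<open>p\<close> elements are represented by their least
  non-negative integer representatives, i.e. by the elements of \<open>{0..<int p}\<close>.
\<close>

definition D0 :: "nat \<Rightarrow> int set" where
  "D0 p = {a \<in> {0..<int p}. a \<noteq> 0 \<and> QuadRes (int p) a}"

definition D1 :: "nat \<Rightarrow> int set" where
  "D1 p = {a \<in> {0..<int p}. \<not> QuadRes (int p) a}"

text \<open>\<open>translate p D b\<close> is the set usually written \<open>D - b\<close>.\<close>

definition translate :: "nat \<Rightarrow> int set \<Rightarrow> int \<Rightarrow> int set" where
  "translate p D b = {c \<in> {0..<int p}. (c + b) mod int p \<in> D}"

text \<open>
  The following three notions are meaningful only if some value of the sequence is repeated.
  This holds for every sequence that takes only finitely many values.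
\<close>

definition first_repeat :: "(nat \<Rightarrow> 'a) \<Rightarrow> nat" where
  "first_repeat s = (LEAST r. 0 < r \<and> s r \<in> s ` {..<r})"

definition preperiod :: "(nat \<Rightarrow> 'a) \<Rightarrow> nat" where
  "preperiod s = (LEAST t. s t = s (first_repeat s))"

definition seq_period :: "(nat \<Rightarrow> 'a) \<Rightarrow> nat" where
  "seq_period s = first_repeat s - preperiod s"

end

theory Submission
  imports Defs
begin

text \<open>
  Since \<open>1 + 2 * 4x(x + 1) = 2(2x + 1)\<^sup>2 - 1\<close>, the map \<open>x \<mapsto> 4x(x + 1)\<close> becomes squaring \<open>w \<mapsto> w\<^sup>2\<close> under
  the substitution \<open>2x + 1 = (w + 1/w) / 2\<close>. Here \<open>w = v\<^sup>2\<close> with \<open>v = d + \<surd>s\<^sub>0\<close> of norm 1, where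
  \<open>d\<^sup>2 = s\<^sub>0 + 1\<close>; by Frobenius, \<open>v\<close> satisfies \<open>v ^ (p - 1) = 1\<close> if \<open>s\<^sub>0\<close> is a residue, and
  \<open>v ^ (p + 1) = 1\<close> otherwise. So the order \<open>D > 1\<close> of \<open>w\<close> divides \<open>N = (p - 1) / 2\<close> or
  \<open>N = (p + 1) / 2\<close>, which is odd in either case. As \<open>w\<close> and \<open>1/w\<close> give the same \<open>x\<close>, the period of
  the sequence is the order of 2 in \<open>(\<int>/D)\<^sup>\<times> / {1, -1}\<close>. It is at most half the totient of \<open>D\<close>,
  hence equal to \<open>(N - 1) / 2\<close> only if \<open>D = N\<close> is prime. Powers of \<open>v\<close> are represented by
  solutions of the Pell equation, so that no field extension is needed.
\<close>

section \<open>Pell solutions modulo a prime\<close>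

text \<open>\<open>pell d n\<close> is the pair \<open>(X, Y)\<close> with \<open>(d + \<surd>(d\<^sup>2 - 1)) ^ n = X + Y * \<surd>(d\<^sup>2 - 1)\<close>.\<close>

primrec pell :: "int \<Rightarrow> nat \<Rightarrow> int \<times> int" where
  "pell d 0 = (1, 0)"
| "pell d (Suc n) =
    (d * fst (pell d n) + (d\<^sup>2 - 1) * snd (pell d n), fst (pell d n) + d * snd (pell d n))"

abbreviation pell_x :: "int \<Rightarrow> nat \<Rightarrow> int" where "pell_x d n \<equiv> fst (pell d n)"
abbreviation pell_y :: "int \<Rightarrow> nat \<Rightarrow> int" where "pell_y d n \<equiv> snd (pell d n)"

lemma pell_equation: "(pell_x d n)\<^sup>2 - (d\<^sup>2 - 1) * (pell_y d n)\<^sup>2 = 1"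
proof (induction n)
  case (Suc n)
  have "(pell_x d (Suc n))\<^sup>2 - (d\<^sup>2 - 1) * (pell_y d (Suc n))\<^sup>2
      = (pell_x d n)\<^sup>2 - (d\<^sup>2 - 1) * (pell_y d n)\<^sup>2"
    by (simp add: algebra_simps power2_eq_square)
  with Suc show ?case by simp
qed simp

lemma pell_add:
  "pell_x d (m + n) = pell_x d m * pell_x d n + (d\<^sup>2 - 1) * pell_y d m * pell_y d n"
  "pell_y d (m + n) = pell_x d m * pell_y d n + pell_y d m * pell_x d n"
proof (induction m)
  case (Suc m)
  {
    case 1
    show ?case by (simp add: Suc algebra_simps power2_eq_square)
  next
    case 2
    show ?case by (simp add: Suc algebra_simps power2_eq_square)
  }
qed simp_all

lemma pell_x_double: "pell_x d (2 * n) = 2 * (pell_x d n)\<^sup>2 - 1"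
proof -
  have "pell_x d (2 * n) = (pell_x d n)\<^sup>2 + (d\<^sup>2 - 1) * (pell_y d n)\<^sup>2"
    by (simp only: mult_2 pell_add power2_eq_square mult.assoc)
  with pell_equation[of d n] show ?thesis by linarith
qed

text \<open>With X as cosh and Y as sinh up to a constant factor, this is cosh(a)^2 - cosh(b)^2 =
  sinh(a + b) sinh(a - b). It factors the difference of two terms of the sequence.\<close>

lemma pell_x_square_diff:
  "(pell_x d (j + k))\<^sup>2 - (pell_x d j)\<^sup>2 = (d\<^sup>2 - 1) * pell_y d (j + k + j) * pell_y d k"
proof -
  \<comment> \<open>\<open>(a, u)\<close> and \<open>(b, v)\<close> stand for the pairs of index
    \<open>j\<close> and \<open>k\<close>, and \<open>x\<close> for \<open>d\<^sup>2 - 1\<close>;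
    the premise is the Pell equation at \<open>k\<close>.\<close>
  have "(a * b + x * u * v)\<^sup>2 - a\<^sup>2 =
      x * ((a * b + x * u * v) * u + (a * v + u * b) * a) * v"
    if "b\<^sup>2 = 1 + x * v\<^sup>2" for a b u v x :: int
  proof -
    have "a\<^sup>2 * b\<^sup>2 = a\<^sup>2 * (1 + x * v\<^sup>2)" using that by simp
    thus ?thesis by (simp add: algebra_simps power2_eq_square)
  qed
  from this[of "pell_x d k" "d\<^sup>2 - 1" "pell_y d k"] show ?thesis
    using pell_equation[of d k] by (simp add: pell_add)
qed

text \<open>In the addition formula one summand vanishes modulo \<open>q\<close>, and the factor
  \<open>pell_x d m\<close> of the other is invertible by the Pell equation.\<close>

lemma pell_y_dvd_add_iff:
  assumes "prime q" "q dvd pell_y d m"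
  shows "q dvd pell_y d (m + n) \<longleftrightarrow> q dvd pell_y d n"
proof -
  have "\<not> q dvd pell_x d m"
  proof
    assume "q dvd pell_x d m"
    hence "q dvd (pell_x d m)\<^sup>2 - (d\<^sup>2 - 1) * (pell_y d m)\<^sup>2"
      using assms by (simp add: power2_eq_square)
    hence "q dvd 1" by (simp only: pell_equation)
    thus False using assms(1) by (auto dest: not_prime_unit)
  qed
  thus ?thesis
    using assms by (simp add: pell_add dvd_add_left_iff prime_dvd_mult_iff)
qed

text \<open>If \<open>q\<close> divides \<open>pell_y d n\<close>, the n-th power is 1 or -1 modulo
  \<open>q\<close>. So \<open>D\<close> is the order of \<open>d + \<surd>(d\<^sup>2 - 1)\<close>
  modulo sign.\<close>

lemma pell_y_rank_of_apparition:
  assumes "prime q" "N > 0" "q dvd pell_y d N"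
  obtains D where "D > 0" "\<And>n. q dvd pell_y d n \<longleftrightarrow> D dvd n"
proof -
  define D where "D = (LEAST n. n > 0 \<and> q dvd pell_y d n)"
  have D: "D > 0 \<and> q dvd pell_y d D"
    unfolding D_def by (rule LeastI[of _ N]) (use assms in auto)
  have least: "n = 0" if "q dvd pell_y d n" "n < D" for n
    using not_less_Least[of n "\<lambda>n. n > 0 \<and> q dvd pell_y d n"] that by (auto simp: D_def)
  have mult: "q dvd pell_y d (D * k + n) \<longleftrightarrow> q dvd pell_y d n" for k n
  proof (induction k)
    case (Suc k)
    thus ?case using pell_y_dvd_add_iff[of q d D "D * k + n"] assms(1) D by (simp add: add.assoc)
  qed simp
  have "q dvd pell_y d n \<longleftrightarrow> D dvd n" for n
  proof -
    have "q dvd pell_y d n \<longleftrightarrow> q dvd pell_y d (n mod D)"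
      using mult[of "n div D" "n mod D"] by simp
    also have "\<dots> \<longleftrightarrow> n mod D = 0"
      using least[of "n mod D"] D by auto
    finally show ?thesis by (simp add: dvd_eq_mod_eq_0)
  qed
  with D that show thesis by blast
qed

text \<open>In the binomial expansion, even powers of the root contribute to X and odd ones to
  Y.\<close>

lemma pell_eq_binomial:
  "pell_x d n = (\<Sum>k\<le>n. of_nat (n choose k) * d ^ (n - k) *
      (if even k then (d\<^sup>2 - 1) ^ (k div 2) else 0))"
  "pell_y d n = (\<Sum>k\<le>n. of_nat (n choose k) * d ^ (n - k) *
      (if odd k then (d\<^sup>2 - 1) ^ (k div 2) else 0))"
proof -
  \<comment> \<open>\<open>F n f\<close> is the image of \<open>(d + T) ^ n\<close> under the linear
    map sending \<open>T ^ k\<close> to \<open>f k\<close>; multiplication by \<open>T\<close> thus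
    shifts \<open>f\<close>.\<close>
  define F :: "nat \<Rightarrow> (nat \<Rightarrow> int) \<Rightarrow> int"
    where "F n f = (\<Sum>k\<le>n. of_nat (n choose k) * d ^ (n - k) * f k)" for n f
  have F_Suc: "F (Suc n) f = d * F n f + F n (\<lambda>k. f (Suc k))" for n f
  proof -
    have "F (Suc n) f = d ^ Suc n * f 0 +
        (\<Sum>k\<le>n. of_nat (n choose k) * d ^ (n - k) * f (Suc k)) +
        (\<Sum>k\<le>n. of_nat (n choose Suc k) * d ^ (n - k) * f (Suc k))"
      unfolding F_def by (subst sum.atMost_Suc_shift) (simp add: algebra_simps sum.distrib)
    \<comment> \<open>The top term has the coefficient \<open>n choose Suc n\<close>, which is 0. In
      the remaining terms \<open>n - k\<close> is positive, so a factor \<open>d\<close> splits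
      off.\<close>
    also have "(\<Sum>k\<le>n. of_nat (n choose Suc k) * d ^ (n - k) * f (Suc k)) =
        (\<Sum>k<n. of_nat (n choose Suc k) * d ^ (n - k) * f (Suc k))"
      by (simp add: lessThan_Suc_atMost[symmetric])
    also have "\<dots> = d * (\<Sum>k<n. of_nat (n choose Suc k) * d ^ (n - Suc k) * f (Suc k))"
      unfolding sum_distrib_left
    proof (intro sum.cong refl)
      fix k assume "k \<in> {..<n}"
      hence "n - k = Suc (n - Suc k)" by auto
      thus "of_nat (n choose Suc k) * d ^ (n - k) * f (Suc k) =
          d * (of_nat (n choose Suc k) * d ^ (n - Suc k) * f (Suc k))" by simp
    qed
    also have "d ^ Suc n * f 0 + (\<Sum>k\<le>n. of_nat (n choose k) * d ^ (n - k) * f (Suc k)) + \<dots>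
        = d * F n f + F n (\<lambda>k. f (Suc k))"
      unfolding F_def sum.atMost_shift[of "\<lambda>k. of_nat (n choose k) * d ^ (n - k) * f k"]
      by (simp add: distrib_left)
    finally show ?thesis .
  qed
  \<comment> \<open>The coordinates of the k-th power of the root with respect to 1 and the
    root.\<close>
  define ev od where "ev = (\<lambda>k. if even k then (d\<^sup>2 - 1) ^ (k div 2) else 0)"
    and "od = (\<lambda>k. if odd k then (d\<^sup>2 - 1) ^ (k div 2) else 0)"
  have ev_Suc: "(\<lambda>k. ev (Suc k)) = (\<lambda>k. (d\<^sup>2 - 1) * od k)" and od_Suc: "(\<lambda>k. od (Suc k)) = ev"
    by (auto simp: ev_def od_def elim!: oddE)
  have scale: "F n (\<lambda>k. c * f k) = c * F n f" for n c f
    by (simp add: F_def sum_distrib_left algebra_simps)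
  have "pell_x d n = F n ev \<and> pell_y d n = F n od"
  proof (induction n)
    case 0
    show ?case by (simp add: F_def ev_def od_def)
  next
    case (Suc n)
    thus ?case by (simp add: F_Suc ev_Suc od_Suc scale)
  qed
  thus "pell_x d n = (\<Sum>k\<le>n. of_nat (n choose k) * d ^ (n - k) *
      (if even k then (d\<^sup>2 - 1) ^ (k div 2) else 0))"
    and "pell_y d n = (\<Sum>k\<le>n. of_nat (n choose k) * d ^ (n - k) *
      (if odd k then (d\<^sup>2 - 1) ^ (k div 2) else 0))"
    by (simp_all add: F_def ev_def od_def)
qed

lemma binomial_sum_cong_prime:
  fixes f :: "nat \<Rightarrow> int"
  assumes "prime p"
  shows "[(\<Sum>k\<le>p. of_nat (p choose k) * f k) = f 0 + f p] (mod int p)"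
proof -
  have "p > 0" using assms by (simp add: prime_gt_0_nat)
  have "{..p} = insert 0 (insert p {0<..<p})" by auto
  hence "(\<Sum>k\<le>p. of_nat (p choose k) * f k) =
      f 0 + f p + (\<Sum>k\<in>{0<..<p}. of_nat (p choose k) * f k)"
    using \<open>p > 0\<close> by simp
  moreover have "int p dvd (\<Sum>k\<in>{0<..<p}. of_nat (p choose k) * f k)"
    by (intro dvd_sum dvd_mult2) (use assms in \<open>auto intro!: dvd_choose_prime\<close>)
  ultimately show ?thesis by (simp add: cong_iff_dvd_diff)
qed

text \<open>Frobenius: modulo \<open>p\<close> only the extreme terms of the binomial expansion
  survive. As \<open>p\<close> is odd, the p-th power of the root falls into Y, and Fermat reduces
  \<open>d ^ p\<close> to \<open>d\<close>.\<close>

lemma pell_prime_cong: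
  assumes "prime p" "odd p"
  shows "[pell_x d p = d] (mod int p)"
    and "[pell_y d p = (d\<^sup>2 - 1) ^ ((p - 1) div 2)] (mod int p)"
proof -
  have p: "p > 0" "(p - 1) div 2 = p div 2" using assms by (auto elim: oddE)
  have "[d ^ p = d] (mod int p)"
  proof (cases "int p dvd d")
    case True
    thus ?thesis using p by (simp add: cong_iff_dvd_diff dvd_power_le[of "int p" d 1 p, simplified])
  next
    case False
    define a where "a = nat (d mod int p)"
    have a: "int a = d mod int p" using p by (simp add: a_def)
    hence "\<not> p dvd a" using False p by (simp add: dvd_mod_iff flip: int_dvd_int_iff)
    hence "[a ^ (p - 1) = 1] (mod p)" using assms(1) by (intro fermat_theorem)
    hence "[a ^ (p - 1) * a = 1 * a] (mod p)" by (rule cong_scalar_right)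
    hence "[a ^ p = a] (mod p)" using p by (metis mult_1 power_minus_mult)
    hence "[int a ^ p = int a] (mod int p)" by (simp flip: cong_int_iff)
    thus ?thesis by (simp add: a cong_def power_mod)
  qed
  moreover have "[pell_x d p = d ^ p] (mod int p)"
    using binomial_sum_cong_prime[OF assms(1),
        of "\<lambda>k. d ^ (p - k) * (if even k then (d\<^sup>2 - 1) ^ (k div 2) else 0)"] assms(2)
    by (simp add: pell_eq_binomial mult.assoc)
  ultimately show "[pell_x d p = d] (mod int p)"
    using cong_trans by blast
  show "[pell_y d p = (d\<^sup>2 - 1) ^ ((p - 1) div 2)] (mod int p)"
    using binomial_sum_cong_prime[OF assms(1),
        of "\<lambda>k. d ^ (p - k) * (if odd k then (d\<^sup>2 - 1) ^ (k div 2) else 0)"] assms(2)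
    unfolding p(2) by (simp add: pell_eq_binomial mult.assoc)
qed

text \<open>By Euler's criterion, the p-th power of v is v or its conjugate, which is 1/v as v has
  norm 1. So v^(p - 1) = 1 or v^(p + 1) = 1; halving the exponent leaves a sign, which Y does not
  see.\<close>

lemma pell_y_half:
  assumes p: "prime p" "odd p" and d: "[d\<^sup>2 \<noteq> 1] (mod int p)"
  shows "QuadRes (int p) (d\<^sup>2 - 1) \<Longrightarrow> int p dvd pell_y d ((p - 1) div 2)"
    and "\<not> QuadRes (int p) (d\<^sup>2 - 1) \<Longrightarrow> int p dvd pell_y d ((p + 1) div 2)"
proof -
  obtain M where M: "p = 2 * M + 1" using p(2) by (elim oddE)
  have "p > 2" using p prime_ge_2_nat[of p] by (cases "p = 2") auto
  \<comment> \<open>By the Pell equation, \<open>pell_x d (2 * n) - 1\<close> is the square of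
    \<open>pell_y d n\<close> times \<open>2 * (d\<^sup>2 - 1)\<close>, and \<open>p\<close> does
    not divide this factor.\<close>
  have half: "int p dvd pell_y d n" if "[pell_x d (2 * n) = 1] (mod int p)" for n
  proof -
    have "pell_x d (2 * n) - 1 = 2 * (d\<^sup>2 - 1) * (pell_y d n)\<^sup>2"
      using pell_equation[of d n] unfolding pell_x_double by (simp add: algebra_simps)
    hence "int p dvd 2 * (d\<^sup>2 - 1) * (pell_y d n)\<^sup>2"
      using that by (simp add: cong_iff_dvd_diff)
    moreover have "prime (int p)" using p(1) by simp
    ultimately have "int p dvd 2 \<or> int p dvd d\<^sup>2 - 1 \<or> int p dvd pell_y d n"
      by (metis prime_dvd_multD prime_dvd_power)
    moreover have "\<not> int p dvd 2"
      using \<open>p > 2\<close> by (auto dest: zdvd_imp_le)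
    ultimately show ?thesis
      using d by (simp only: cong_iff_dvd_diff) blast
  qed
  note x = pell_prime_cong(1)[OF p, of d]
  have y: "[pell_y d p = Legendre (d\<^sup>2 - 1) (int p)] (mod int p)"
    using pell_prime_cong(2)[OF p, of d] euler_criterion[OF p(1) \<open>p > 2\<close>, of "d\<^sup>2 - 1"]
    by (meson cong_sym cong_trans)
  have nz: "\<not> [d\<^sup>2 - 1 = 0] (mod int p)"
    using d by (simp add: cong_iff_dvd_diff)
  {
    assume "QuadRes (int p) (d\<^sup>2 - 1)"
    hence "[pell_y d p = 1] (mod int p)" using y nz by (simp add: Legendre_def)
    hence "[d * pell_x d p - (d\<^sup>2 - 1) * pell_y d p = d * d - (d\<^sup>2 - 1) * 1] (mod int p)"
      using x by (intro cong_diff cong_scalar_left)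
    \<comment> \<open>Multiplying by the conjugate of v lowers the index from \<open>p\<close> to
      \<open>2 * M\<close>.\<close>
    moreover have "pell_x d (2 * M) = d * pell_x d p - (d\<^sup>2 - 1) * pell_y d p"
      by (simp add: M algebra_simps power2_eq_square)
    ultimately have "[pell_x d (2 * M) = 1] (mod int p)" by (simp add: power2_eq_square)
    from half[OF this] show "int p dvd pell_y d ((p - 1) div 2)" by (simp add: M)
  next
    assume "\<not> QuadRes (int p) (d\<^sup>2 - 1)"
    hence "[pell_y d p = -1] (mod int p)" using y nz by (simp add: Legendre_def)
    hence "[d * pell_x d p + (d\<^sup>2 - 1) * pell_y d p = d * d + (d\<^sup>2 - 1) * -1] (mod int p)"
      using x by (intro cong_add cong_scalar_left)
    moreover have "pell_x d (2 * (M + 1)) = d * pell_x d p + (d\<^sup>2 - 1) * pell_y d p"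
      by (simp add: M)
    ultimately have "[pell_x d (2 * (M + 1)) = 1] (mod int p)" by (simp add: power2_eq_square)
    from half[OF this] show "int p dvd pell_y d ((p + 1) div 2)" by (simp add: M)
  }
qed


section \<open>Orders of residues modulo sign\<close>

text \<open>The order of \<open>a\<close> in \<open>(\<int>/n)\<^sup>\<times> / {1, -1}\<close>, meaningful only if \<open>a\<close> and \<open>n\<close> are coprime.\<close>

definition signed_ord :: "nat \<Rightarrow> nat \<Rightarrow> nat" where
  "signed_ord n a = (LEAST k. 0 < k \<and> ([a ^ k = 1] (mod n) \<or> n dvd a ^ k + 1))"

lemma signed_ord:
  assumes "coprime n a"
  shows "signed_ord n a > 0"
    and "[a ^ signed_ord n a = 1] (mod n) \<or> n dvd a ^ signed_ord n a + 1"
    and "signed_ord n a \<le> ord n a"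
proof -
  have *: "0 < ord n a \<and> ([a ^ ord n a = 1] (mod n) \<or> n dvd a ^ ord n a + 1)"
    using assms ord[of a n] by simp
  show "signed_ord n a > 0"
    and "[a ^ signed_ord n a = 1] (mod n) \<or> n dvd a ^ signed_ord n a + 1"
    using LeastI[of "\<lambda>k. 0 < k \<and> ([a ^ k = 1] (mod n) \<or> n dvd a ^ k + 1)", OF *]
    unfolding signed_ord_def by auto
  show "signed_ord n a \<le> ord n a"
    unfolding signed_ord_def using * by (rule Least_le)
qed

lemma not_dvd_if_less_signed_ord: "0 < k \<Longrightarrow> k < signed_ord n a \<Longrightarrow> \<not> n dvd a ^ k + 1"
  unfolding signed_ord_def using not_less_Least by blast

text \<open>Squaring removes the sign, so the order divides \<open>2 * signed_ord n a\<close>; it is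
  also at least \<open>signed_ord n a\<close>. If the two are equal, -1 is not a power of
  \<open>a\<close>.\<close>

lemma ord_signed_ord_cases:
  assumes "coprime n a" "n > 2"
  obtains "ord n a = 2 * signed_ord n a"
  | "ord n a = signed_ord n a" "\<And>k. \<not> n dvd a ^ k + 1"
proof -
  let ?K = "signed_ord n a"
  have "[a ^ (2 * ?K) = 1] (mod n)"
    using signed_ord(2)[OF assms(1)]
  proof
    assume "[a ^ ?K = 1] (mod n)"
    from cong_pow[OF this, of 2] show ?thesis by (simp add: power_mult mult.commute flip: power_mult)
  next
    assume "n dvd a ^ ?K + 1"
    hence "int n dvd int (a ^ ?K + 1)" by (simp only: int_dvd_int_iff)
    hence "int n dvd (int a ^ ?K + 1) * (int a ^ ?K - 1)" by (intro dvd_mult2) (simp add: add.commute)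
    also have "\<dots> = int a ^ (2 * ?K) - 1" by (simp add: algebra_simps flip: power_add mult_2)
    finally have "[int (a ^ (2 * ?K)) = int 1] (mod int n)" by (simp add: cong_iff_dvd_diff)
    thus ?thesis by (simp only: cong_int_iff)
  qed
  hence "ord n a dvd 2 * ?K" by (simp only: ord_divides)
  then obtain j where j: "2 * ?K = ord n a * j" by (elim dvdE)
  hence "2 * ?K \<ge> ?K * j" using signed_ord(3)[OF assms(1)] by simp
  hence "j \<le> 2" using signed_ord(1)[OF assms(1)] by simp
  moreover have "j \<noteq> 0" using j signed_ord(1)[OF assms(1)] by (cases "j = 0") simp_all
  ultimately have "j = 1 \<or> j = 2" by auto
  thus thesis
  proof
    assume "j = 1"
    thus thesis using j that(1) by simp
  next
    assume "j = 2"
    hence eq: "ord n a = ?K" using j by simp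
    \<comment> \<open>Reduce the exponent modulo \<open>?K\<close>: a positive remainder contradicts
      minimality, and remainder 0 would give \<open>n dvd 2\<close>.\<close>
    have "\<not> n dvd a ^ k + 1" for k
    proof
      assume k: "n dvd a ^ k + 1"
      let ?r = "k mod ?K"
      have "a ^ k = a ^ (?K * (k div ?K) + ?r)" by simp
      hence "a ^ k = (a ^ ?K) ^ (k div ?K) * a ^ ?r" by (simp only: power_add power_mult)
      moreover have "[(a ^ ?K) ^ (k div ?K) = 1 ^ (k div ?K)] (mod n)"
        using ord[of a n] unfolding eq by (rule cong_pow)
      ultimately have "[a ^ k = a ^ ?r] (mod n)"
        by (metis cong_scalar_right mult_1 power_one)
      hence "[a ^ k + 1 = a ^ ?r + 1] (mod n)" by (intro cong_add) auto
      hence r: "n dvd a ^ ?r + 1" using k by (simp only: cong_dvd_iff)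
      show False
      proof (cases "?r = 0")
        case True
        hence "n dvd 2" using r by (simp add: numeral_2_eq_2)
        thus False using assms(2) by (auto dest: dvd_imp_le)
      next
        case False
        have "?r < ?K" using signed_ord(1)[OF assms(1)] by simp
        with not_dvd_if_less_signed_ord[of ?r n a] r False show False by simp
      qed
    qed
    with eq that(2) show thesis by blast
  qed
qed

text \<open>If -1 is not a power of \<open>a\<close>, then \<open>a\<close> is no generator of the
  unit group, so its order is a proper divisor of the totient.\<close>

lemma signed_ord_le_half_totient:
  assumes "coprime n a" "n > 2"
  shows "2 * signed_ord n a \<le> totient n"
proof -
  have dvd: "ord n a dvd totient n" using assms(1) by (intro order_divides_totient)
  have "totient n > 0" using assms(2) by simp
  from assms show ?thesis
  proof (cases rule: ord_signed_ord_cases)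
    case 1
    thus ?thesis using dvd \<open>totient n > 0\<close> by (metis dvd_imp_le)
  next
    case 2
    have "ord n a \<noteq> totient n"
    proof
      assume "ord n a = totient n"
      hence "residue_primroot n a" using assms by (simp add: residue_primroot_def)
      hence "totatives n = (\<lambda>i. a ^ i mod n) ` {..<totient n}"
        using residue_primroot_is_generator[of n a] assms by (simp add: bij_betw_def)
      moreover have "n - 1 \<in> totatives n"
        using assms(2) coprime_diff_one_left_nat[of n]
        by (simp add: totatives_def del: coprime_diff_one_left_nat)
      ultimately obtain i where i: "n - 1 = a ^ i mod n" by auto
      have "(a ^ i + 1) mod n = (n - 1 + 1) mod n" unfolding i by (simp add: mod_Suc_eq)
      hence "n dvd a ^ i + 1" using assms(2) by (simp add: dvd_eq_mod_eq_0)
      with 2(2) show False by blast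
    qed
    moreover obtain j where j: "totient n = ord n a * j" using dvd by (elim dvdE)
    ultimately have "j \<noteq> 0" "j \<noteq> 1" using \<open>totient n > 0\<close> by auto
    hence "ord n a * 2 \<le> ord n a * j" by (intro mult_le_mono2) auto
    thus ?thesis using 2(1) j by simp
  qed
qed

text \<open>If the common value were \<open>2 * h\<close>, then \<open>a ^ h\<close> would be a
  square root of 1 modulo a prime, hence 1 or -1, against minimality.\<close>

lemma odd_signed_ord_prime:
  assumes "prime n" "coprime n a" "n > 2" "ord n a = signed_ord n a"
  shows "odd (signed_ord n a)"
proof
  assume "even (signed_ord n a)"
  then obtain h where h: "signed_ord n a = 2 * h" by (elim evenE)
  have pos: "h > 0" using signed_ord(1)[OF assms(2)] h by simp
  have "[int (a ^ (2 * h)) = int 1] (mod int n)"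
    using ord[of a n] unfolding assms(4) h cong_int_iff .
  hence "int n dvd int a ^ (2 * h) - 1" by (simp add: cong_iff_dvd_diff)
  also have "int a ^ (2 * h) - 1 = (int a ^ h + 1) * (int a ^ h - 1)"
    by (simp add: algebra_simps flip: power_add mult_2)
  finally have "int n dvd int a ^ h + 1 \<or> int n dvd int a ^ h - 1"
    using assms(1) by (simp add: prime_dvd_mult_iff)
  moreover have "int a ^ h + 1 = int (a ^ h + 1)" by simp
  ultimately have "n dvd a ^ h + 1 \<or> [int (a ^ h) = int 1] (mod int n)"
    by (metis cong_iff_dvd_diff int_dvd_int_iff of_nat_1 of_nat_power)
  hence "n dvd a ^ h + 1 \<or> [a ^ h = 1] (mod n)" by (simp only: cong_int_iff)
  with not_dvd_if_less_signed_ord[of h n a] ord_minimal[of h n a] pos h assms(4)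
  show False by simp
qed

text \<open>The order is either twice \<open>signed_ord n a\<close>, hence even, or equal to it and
  odd. The oddness condition tells these cases apart.\<close>

lemma signed_ord_prime_eq_half_iff:
  assumes "prime n" "coprime n a" "n > 2"
  shows "signed_ord n a = (n - 1) div 2 \<longleftrightarrow>
    ord n a = n - 1 \<or> (ord n a = (n - 1) div 2 \<and> odd ((n - 1) div 2))"
proof -
  have "odd n" using assms prime_odd_nat by blast
  then obtain m where m: "n = 2 * m + 1" by (elim oddE)
  have le: "signed_ord n a \<le> m"
    using signed_ord_le_half_totient[OF assms(2,3)] totient_prime[OF assms(1)] m by simp
  have pos: "signed_ord n a > 0" using assms(2) by (rule signed_ord)
  from assms(2,3) show ?thesis
  proof (cases rule: ord_signed_ord_cases)
    case 1
    moreover have "signed_ord n a \<noteq> m" if "ord n a = m" "odd m"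
      using 1 that pos by simp
    moreover have "even m" if "ord n a = m" using 1 that by simp
    ultimately show ?thesis using m by auto
  next
    case 2
    thus ?thesis using m pos le odd_signed_ord_prime[OF assms(1-3)] by auto
  qed
qed

text \<open>Equality forces N - 1 \<le> totient D \<le> D - 1 \<le> N - 1, so \<open>D = N\<close>
  is prime. Conversely, a prime \<open>N\<close> has no other divisor above 2.\<close>

lemma signed_ord_divisor_eq_half_iff:
  assumes "D dvd N" "D > 2" "odd N" "coprime D a"
  shows "signed_ord D a = (N - 1) div 2 \<longleftrightarrow>
    prime N \<and> (ord N a = N - 1 \<or> (ord N a = (N - 1) div 2 \<and> odd ((N - 1) div 2)))"
proof -
  have "N > 0" using assms(3) by (intro Nat.gr0I) auto
  hence "D \<le> N" using assms(1) by (rule dvd_imp_le[rotated])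
  have "D = N \<and> prime N" if "signed_ord D a = (N - 1) div 2"
  proof -
    have "N - 1 \<le> totient D"
      using signed_ord_le_half_totient[OF assms(4,2)] that assms(3) by (auto elim: oddE)
    moreover have "totient D < D" using assms(2) by (intro totient_less) auto
    ultimately have "D = N" "totient D = D - 1" using \<open>D \<le> N\<close> by auto
    thus ?thesis using totient_imp_prime \<open>N > 0\<close> by simp
  qed
  moreover have "D = N" if "prime N"
    using that assms(1,2) by (auto simp: prime_nat_iff)
  ultimately show ?thesis
    using signed_ord_prime_eq_half_iff[of N a] assms(2,4) by blast
qed


section \<open>The period of the logistic sequence\<close>

text \<open>Whether a shift by \<open>k\<close> repeats a term is independent of the position, so
  the sequence is purely periodic and \<open>preperiod s\<close> is 0.\<close>

lemma seq_period_eq_Least: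
  assumes "\<And>m k. s (m + k) = s m \<longleftrightarrow> Q k" and "k > 0" "Q k"
  shows "seq_period s = (LEAST k. 0 < k \<and> Q k)"
proof -
  define K where "K = (LEAST k. 0 < k \<and> Q k)"
  have K: "0 < K \<and> Q K" unfolding K_def by (rule LeastI[of _ k]) (use assms in auto)
  have K_le: "K \<le> k" if "0 < k" "Q k" for k
    unfolding K_def using that by (intro Least_le) auto
  have "first_repeat s = K"
    unfolding first_repeat_def
  proof (rule Least_equality)
    have "s K = s 0" using K assms(1)[of 0 K] by simp
    with K show "0 < K \<and> s K \<in> s ` {..<K}" by auto
  next
    fix r assume "0 < r \<and> s r \<in> s ` {..<r}"
    then obtain t where t: "t < r" "s r = s t" by auto
    hence "Q (r - t)" using assms(1)[of t "r - t"] by simp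
    with K_le[of "r - t"] t show "K \<le> r" by simp
  qed
  moreover have "s 0 = s K" using K assms(1)[of 0 K] by simp
  ultimately have "preperiod s = 0"
    unfolding preperiod_def by (intro Least_equality) auto
  with \<open>first_repeat s = K\<close> show ?thesis by (simp add: seq_period_def K_def)
qed

text \<open>In terms of X, the map sends X^2 - 1 to (2X^2 - 1)^2 - 1, which doubles the Pell
  index.\<close>

lemma logistic_cong_pell:
  fixes s :: "nat \<Rightarrow> int"
  assumes "[s 0 = d\<^sup>2 - 1] (mod q)" and "\<And>n. s (Suc n) = (4 * s n * (s n + 1)) mod q"
  shows "[s n = (pell_x d (2 ^ n))\<^sup>2 - 1] (mod q)"
proof (induction n)
  case 0
  show ?case using assms(1) by simp
next
  case (Suc n)
  let ?x = "pell_x d (2 ^ n)"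
  have "[s (Suc n) = 4 * s n * (s n + 1)] (mod q)" by (simp add: assms(2))
  also have "[4 * s n * (s n + 1) = 4 * (?x\<^sup>2 - 1) * (?x\<^sup>2 - 1 + 1)] (mod q)"
    using Suc by (intro cong_mult cong_add cong_refl)
  also have "4 * (?x\<^sup>2 - 1) * (?x\<^sup>2 - 1 + 1) = (2 * ?x\<^sup>2 - 1)\<^sup>2 - 1"
    by (simp add: algebra_simps power2_eq_square)
  also have "\<dots> = (pell_x d (2 ^ Suc n))\<^sup>2 - 1"
    by (simp add: pell_x_double)
  finally show ?case .
qed

text \<open>By \<open>pell_x_square_diff\<close>, the terms agree iff \<open>D\<close> divides
  \<open>2 ^ m * (2 ^ k + 1)\<close> or \<open>2 ^ m * (2 ^ k - 1)\<close>. As \<open>D\<close> is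
  odd, \<open>2 ^ m\<close> cancels.\<close>

lemma logistic_eq_iff:
  fixes s :: "nat \<Rightarrow> int"
  assumes q: "prime q" "[d\<^sup>2 \<noteq> 1] (mod q)" and D: "odd D" "\<And>n. q dvd pell_y d n \<longleftrightarrow> D dvd n"
    and range: "\<And>n. s n \<in> {0..<q}" and s: "\<And>n. [s n = (pell_x d (2 ^ n))\<^sup>2 - 1] (mod q)"
  shows "s (m + k) = s m \<longleftrightarrow> [2 ^ k = 1] (mod D) \<or> D dvd 2 ^ k + 1"
proof -
  obtain l where l: "(2::nat) ^ k = l + 1"
    by (metis add.commute le_Suc_ex one_le_numeral one_le_power plus_1_eq_Suc)
  have cop: "coprime D (2 ^ m)" using D(1) by simp
  have "s (m + k) = s m \<longleftrightarrow> [s (m + k) = s m] (mod q)"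
    using range[of "m + k"] range[of m] by (simp add: cong_def)
  also have "\<dots> \<longleftrightarrow> [(pell_x d (2 ^ (m + k)))\<^sup>2 - 1 = (pell_x d (2 ^ m))\<^sup>2 - 1] (mod q)"
    using s[of "m + k"] s[of m] by (meson cong_sym cong_trans)
  also have "\<dots> \<longleftrightarrow> q dvd (pell_x d (2 ^ m + 2 ^ m * l))\<^sup>2 - (pell_x d (2 ^ m))\<^sup>2"
    by (simp add: cong_iff_dvd_diff power_add l)
  also have "\<dots> \<longleftrightarrow> q dvd pell_y d (2 ^ m + 2 ^ m * l + 2 ^ m) \<or> q dvd pell_y d (2 ^ m * l)"
    unfolding pell_x_square_diff using q by (simp add: prime_dvd_mult_iff cong_iff_dvd_diff)
  also have "2 ^ m + 2 ^ m * l + 2 ^ m = 2 ^ m * (2 ^ k + 1)" by (simp add: l)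
  also have "q dvd pell_y d (2 ^ m * (2 ^ k + 1)) \<or> q dvd pell_y d (2 ^ m * l) \<longleftrightarrow>
      D dvd 2 ^ k + 1 \<or> D dvd l"
    unfolding D(2) coprime_dvd_mult_right_iff[OF cop] ..
  also have "D dvd l \<longleftrightarrow> [2 ^ k = 1] (mod D)"
    by (simp add: l cong_altdef_nat)
  finally show ?thesis by blast
qed

section \<open>The criterion for the maximal period\<close>

theorem corollary17:
  fixes p :: nat and s :: "nat \<Rightarrow> int"
  assumes "prime p" and "p > 3"
    and "p mod 4 = 3 \<Longrightarrow> s 0 \<in> D0 p \<inter> translate p (D0 p) 1"
    and "p mod 4 = 1 \<Longrightarrow> s 0 \<in> D1 p \<inter> translate p (D0 p) 1"
    and "\<And>n. s (Suc n) = (4 * s n * (s n + 1)) mod int p"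
  shows "((p mod 4 = 3 \<longrightarrow> seq_period s = (p - 3) div 4) \<and>
          (p mod 4 = 1 \<longrightarrow> seq_period s = (p - 1) div 4)) \<longleftrightarrow>
         (\<exists>p1::nat. prime p1 \<and>
            (p mod 4 = 3 \<longrightarrow> p = 2 * p1 + 1) \<and>
            (p mod 4 = 1 \<longrightarrow> p = 2 * p1 - 1) \<and>
            (ord p1 2 = p1 - 1 \<or>
             (ord p1 2 = (p1 - 1) div 2 \<and> odd ((p1 - 1) div 2))))"
proof -
  have p: "prime (int p)" "odd p" using assms(1,2) prime_odd_nat[of p] by auto
  have p4: "p mod 4 = 3 \<or> p mod 4 = 1" using p(2) by presburger
  \<comment> \<open>The index supplied by \<open>pell_y_half\<close>, and the only candidate for
    \<open>p1\<close>. In both cases it is \<open>2 * (p div 4) + 1\<close>, hence odd.\<close>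
  define N where "N = (if p mod 4 = 3 then (p - 1) div 2 else (p + 1) div 2)"
  have N: "odd N" "N > 0"
    and half: "p mod 4 = 3 \<Longrightarrow> (p - 3) div 4 = (N - 1) div 2"
      "p mod 4 = 1 \<Longrightarrow> (p - 1) div 4 = (N - 1) div 2"
    and N_eq: "\<And>n. n > 0 \<Longrightarrow>
      (p mod 4 = 3 \<longrightarrow> p = 2 * n + 1) \<and> (p mod 4 = 1 \<longrightarrow> p = 2 * n - 1) \<longleftrightarrow> n = N"
  proof -
    define M where "M = p div 4"
    have "p = 4 * M + p mod 4" by (simp add: M_def)
    with p4 have M: "p mod 4 = 3 \<and> p = 4 * M + 3 \<or> p mod 4 = 1 \<and> p = 4 * M + 1" by auto
    hence NM: "N = 2 * M + 1" by (elim disjE conjE) (simp_all add: N_def)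
    from NM show "odd N" "N > 0" by simp_all
    show "(p - 3) div 4 = (N - 1) div 2" if "p mod 4 = 3"
    proof -
      have "p - 3 = 4 * M" using M that by auto
      thus ?thesis by (simp add: NM)
    qed
    show "(p - 1) div 4 = (N - 1) div 2" if "p mod 4 = 1"
    proof -
      have "p - 1 = 4 * M" using M that by auto
      thus ?thesis by (simp add: NM)
    qed
    show "(p mod 4 = 3 \<longrightarrow> p = 2 * n + 1) \<and> (p mod 4 = 1 \<longrightarrow> p = 2 * n - 1) \<longleftrightarrow> n = N"
      if "n > 0" for n
      using M
    proof (elim disjE conjE)
      assume "p mod 4 = 3" "p = 4 * M + 3"
      moreover have "4 * M + 3 = 2 * n + 1 \<longleftrightarrow> n = 2 * M + 1" by linarith
      ultimately show ?thesis using NM by simp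
    next
      assume "p mod 4 = 1" "p = 4 * M + 1"
      moreover have "4 * M + 1 = 2 * n - 1 \<longleftrightarrow> n = 2 * M + 1" using that by linarith
      ultimately show ?thesis using NM by simp
    qed
  qed

  have s0: "s 0 \<in> {0..<int p}" "(s 0 + 1) mod int p \<in> D0 p"
    using assms(3,4) p4 by (auto simp: translate_def)
  have s0_nz: "\<not> int p dvd s 0" and s0_QR: "QuadRes (int p) (s 0) \<longleftrightarrow> p mod 4 = 3"
  proof -
    \<comment> \<open>\<open>QuadRes\<close> admits 0 as a residue, so 0 lies outside
      \<open>D1\<close> as well as outside \<open>D0\<close>.\<close>
    have "QuadRes (int p) 0" unfolding QuadRes_def by (rule exI[of _ 0]) simp
    hence "s 0 \<noteq> 0" using assms(3,4) p4 by (auto simp: D0_def D1_def)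
    thus "\<not> int p dvd s 0" using s0(1) by (auto dest: zdvd_imp_le)
    show "QuadRes (int p) (s 0) \<longleftrightarrow> p mod 4 = 3"
      using assms(3,4) p4 by (auto simp: D0_def D1_def)
  qed
  \<comment> \<open>A square root \<open>d\<close> of \<open>s 0 + 1\<close> makes
    \<open>d\<^sup>2 - 1\<close> congruent to \<open>s 0\<close>, which starts the Pell
    description.\<close>
  obtain d where "[d\<^sup>2 = (s 0 + 1) mod int p] (mod int p)"
    using s0(2) by (auto simp: D0_def QuadRes_def)
  hence "[s 0 + 1 = d\<^sup>2] (mod int p)" by (simp add: cong_sym_eq)
  from cong_diff[OF this cong_refl[of 1]] have d: "[s 0 = d\<^sup>2 - 1] (mod int p)" by simp
  have d_nz: "[d\<^sup>2 \<noteq> 1] (mod int p)"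
    using s0_nz unfolding cong_dvd_iff[OF d] cong_iff_dvd_diff .
  have "QuadRes (int p) (d\<^sup>2 - 1) \<longleftrightarrow> p mod 4 = 3"
    unfolding s0_QR[symmetric] QuadRes_def
    using cong_trans[OF _ d] cong_trans[OF _ cong_sym[OF d]] by blast
  hence "int p dvd pell_y d N"
    using pell_y_half[OF assms(1) p(2) d_nz] unfolding N_def by auto
  then obtain D where D: "D > 0" "\<And>n. int p dvd pell_y d n \<longleftrightarrow> D dvd n"
    using pell_y_rank_of_apparition[OF p(1) N(2)] by blast
  have "D dvd N" using D(2) \<open>int p dvd pell_y d N\<close> by simp
  hence "odd D" using N(1) dvd_trans by blast
  \<comment> \<open>\<open>pell_y d 1\<close> is 1, which \<open>p\<close> does not divide.\<close>
  moreover have "D \<noteq> 1" using D(2)[of 1] assms(2) by auto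
  ultimately have "D > 2" using D(1) by (cases "D = 2") auto
  have cop: "coprime D 2" using \<open>odd D\<close> by simp

  have range: "s n \<in> {0..<int p}" for n
    using s0(1) assms(2) by (cases n) (auto simp: assms(5))
  note eq = logistic_eq_iff[of "int p" d D s, OF p(1) d_nz \<open>odd D\<close> D(2) range
      logistic_cong_pell[OF d assms(5)]]
  have "seq_period s = signed_ord D 2"
    unfolding signed_ord_def using signed_ord(1,2)[OF cop] by (intro seq_period_eq_Least eq)
  hence "(p mod 4 = 3 \<longrightarrow> seq_period s = (p - 3) div 4) \<and>
      (p mod 4 = 1 \<longrightarrow> seq_period s = (p - 1) div 4) \<longleftrightarrow> signed_ord D 2 = (N - 1) div 2"
    using p4 half by auto
  also have "\<dots> \<longleftrightarrow> prime N \<and> (ord N 2 = N - 1 \<or> (ord N 2 = (N - 1) div 2 \<and> odd ((N - 1) div 2)))"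
    using \<open>D dvd N\<close> \<open>D > 2\<close> N(1) cop by (rule signed_ord_divisor_eq_half_iff)
  finally show ?thesis
    using N_eq[OF prime_gt_0_nat] N_eq[OF N(2)] by blast
qed

end
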